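(* Let $s\ge 1$ be an integer and assume that $\mu<\frac{1}{2s-1}$. Let $c\in\mathbb{R}^N$ and $y=Tc+z$, where $z\in\mathcal{H}$ is an unknown noise term with $\|z\|\le\varepsilon$. Then the solution $c^*$ of the problem $$(P_{1,w})\qquad \min_{\tilde c\in\mathbb{R}^N}\|\tilde c\|_{1,w}\quad\text{subject to}\quad \|y-T\tilde c\|\le\eta$$ obeys $$\|c^*-c\|_{2,w}\le\frac{\sqrt{3-\frac{1}{2s-1}}}{1-\mu(2s-1)}\,(\eta+\varepsilon)+\frac{2\sqrt{\mu s(1+\mu)}}{1-\mu(2s-1)}\,e_0,\qquad\text{where } e_0=\frac{\|c-c_s\|_{1,w}}{\sqrt{s}}.$$
   Context: $\mathcal{H}$ is a real $n$-dimensional inner product space with inner product $\langle\cdot,\cdot\rangle$ and norm $\|\cdot\|$, and $\mathcal{F}=\{f_1,\dots,f_N\}\subset\mathcal{H}$ is a finite family of vectors with $w_i:=\|f_i\|\neq 0$ for all $i=1,\dots,N$. The synthesis operator is $T:\mathbb{R}^N\to\mathcal{H}$, $T(c_1,\dots,c_N)=\sum_{j=1}^N c_jf_j$. The coherence of $\mathcal{F}$ is $\mu:=\max_{i\ne j}\frac{|\langle f_i,f_j\rangle|}{\|f_i\|\,\|f_j\|}$. For $c\in\mathbb{R}^N$ and $0<p<\infty$, $\|c\|_{p,w}:=\left(\sum_{i=1}^N|c_i|^pw_i^p\right)^{1/p}$. For $c\in\mathbb{R}^N$, $c_s$ denotes the vector $c$ with all but its $s$ largest entries (in absolute value) set to zero.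 The numbers $\varepsilon,\eta\ge 0$ are the noise bound and the tolerance in the constraint of $(P_{1,w})$.
   Formalization: The formal theorem additionally assumes ‖z‖ ≤ η, i.e. that c itself is admissible in (P_{1,w}) (implied by ε ≤ η); without this the claim is false, e.g. for three unit vectors with pairwise inner products −0.49, s=1, c=0, η=0, z=f₁+f₂+f₃. *)

theory Defs
  imports "HOL-Analysis.Analysis"
begin

definition synthesis :: "('N::finite \<Rightarrow> 'a::real_vector) \<Rightarrow> real ^ 'N \<Rightarrow> 'a" where
  "synthesis f c = (\<Sum>j\<in>UNIV. (c $ j) *\<^sub>R f j)"

(* Inserting 0 only matters for a one-element family, where there is no pair
   of distinct indices; all the other values are nonnegative. *)
definition coherence :: "('N::finite \<Rightarrow> 'a::real_inner) \<Rightarrow> real" where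
  "coherence f = Max (insert 0 {\<bar>f i \<bullet> f j\<bar> / (norm (f i) * norm (f j)) | i j. i \<noteq> j})"

definition wnorm :: "real \<Rightarrow> ('N::finite \<Rightarrow> real) \<Rightarrow> real ^ 'N \<Rightarrow> real" where
  "wnorm p w c = (\<Sum>i\<in>UNIV. \<bar>c $ i\<bar> powr p * w i powr p) powr (1 / p)"

(* cs is c with all but s entries of largest absolute value set to zero. This is
   a relation because ties can be broken in several ways. The absolute values
   are unweighted. If s exceeds the number of entries, then cs = c. *)
definition largest_entries :: "nat \<Rightarrow> real ^ 'N::finite \<Rightarrow> real ^ 'N \<Rightarrow> bool" where
  "largest_entries s c cs \<longleftrightarrow>
     (\<exists>S. card S = min s CARD('N) \<and>
          (\<forall>i\<in>S. \<forall>j\<in>-S. \<bar>c $ j\<bar> \<le> \<bar>c $ i\<bar>) \<and>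
          cs = (\<chi> i. if i \<in> S then c $ i else 0))"

(* Any minimizer: the solution is not required to be unique. *)
definition P1w_solution ::
    "('N::finite \<Rightarrow> 'a::real_inner) \<Rightarrow> 'a \<Rightarrow> real \<Rightarrow> real ^ 'N \<Rightarrow> bool" where
  "P1w_solution f y \<eta> cstar \<longleftrightarrow>
     is_arg_min (wnorm 1 (\<lambda>i. norm (f i))) (\<lambda>c'. norm (y - synthesis f c') \<le> \<eta>) cstar"

end

theory Submission
  imports Defs
begin

text \<open>
  Put \<open>h = cstar - c\<close> and \<open>u\<^sub>i = h\<^sub>i f\<^sub>i\<close>, so that the weighted norms of \<open>h\<close> are the plain
  norms of the family \<open>(\<parallel>u\<^sub>i\<parallel>)\<close>. Let \<open>S\<close> be the set of kept indices, \<open>a\<close> and \<open>X\<close> the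
  2-norms of \<open>u\<close> on \<open>S\<close> and on all indices, \<open>\<tau> = \<eta> + \<epsilon>\<close> and \<open>D = 1 - \<mu>(2s - 1)\<close>. Minimality of
  \<open>cstar\<close> gives the cone condition \<open>\<parallel>u\<parallel>\<^sub>1 \<le> 2\<surd>s(a + e\<^sub>0)\<close>. Bounding \<open>\<langle>\<Sum>\<^sub>S u, \<Sum> u\<rangle>\<close> from below
  by coherence gives \<open>D a \<le> \<tau>\<surd>(1 + (s - 1)\<mu>) + 2\<mu>s e\<^sub>0\<close>, and bounding \<open>\<parallel>\<Sum> u\<parallel>\<^sup>2\<close> from below gives
  \<open>(1 + \<mu>)X\<^sup>2 \<le> \<tau>\<^sup>2 + 4s\<mu>(a + e\<^sub>0)\<^sup>2\<close>. Inserting the first bound into the second and applying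
  Minkowski's inequality in the plane yields the theorem; the constant \<open>3 - 1/(2s - 1)\<close> is the
  value at \<open>\<mu> = 1/(2s - 1)\<close> of an expression that increases with \<open>\<mu>\<close>.
\<close>

section \<open>Coherence and weighted norms\<close>

lemma finite_correlations:
  fixes f :: "'N::finite \<Rightarrow> 'a::real_inner"
  shows "finite {\<bar>f i \<bullet> f j\<bar> / (norm (f i) * norm (f j)) | i j. i \<noteq> j}"
proof (rule finite_subset)
  show "{\<bar>f i \<bullet> f j\<bar> / (norm (f i) * norm (f j)) | i j. i \<noteq> j}
      \<subseteq> range (\<lambda>(i, j). \<bar>f i \<bullet> f j\<bar> / (norm (f i) * norm (f j)))"
    by auto
qed simp

lemma abs_inner_le_coherence:
  fixes f :: "'N::finite \<Rightarrow> 'a::real_inner"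
  assumes "i \<noteq> j"
  shows "\<bar>f i \<bullet> f j\<bar> \<le> coherence f * (norm (f i) * norm (f j))"
proof (cases "f i = 0 \<or> f j = 0")
  case False
  have "\<bar>f i \<bullet> f j\<bar> / (norm (f i) * norm (f j)) \<le> coherence f"
    unfolding coherence_def using assms by (intro Max_ge) (auto simp: finite_correlations)
  with False show ?thesis
    by (simp add: divide_le_eq)
qed auto

lemma coherence_nonneg:
  fixes f :: "'N::finite \<Rightarrow> 'a::real_inner"
  shows "0 \<le> coherence f"
  unfolding coherence_def by (intro Max_ge) (auto simp: finite_correlations)

lemma wnorm_1_eq:
  assumes "\<And>i. 0 \<le> w i"
  shows "wnorm 1 w c = (\<Sum>i\<in>UNIV. \<bar>c $ i\<bar> * w i)"
  unfolding wnorm_def by (simp add: assms sum_nonneg)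

lemma wnorm_2_eq:
  assumes "\<And>i. 0 \<le> w i"
  shows "wnorm 2 w c = sqrt (\<Sum>i\<in>UNIV. (\<bar>c $ i\<bar> * w i)\<^sup>2)"
proof -
  have "\<bar>c $ i\<bar> powr 2 * w i powr 2 = (\<bar>c $ i\<bar> * w i)\<^sup>2" for i
    using assms[of i] by (simp add: powr_numeral power_mult_distrib)
  then show ?thesis
    unfolding wnorm_def by (simp add: powr_half_sqrt sum_nonneg)
qed

section \<open>Sums of vectors with small pairwise inner products\<close>

lemma abs_inner_sum_le:
  fixes u :: "'i \<Rightarrow> 'a::real_inner"
  assumes "\<And>i j. i \<noteq> j \<Longrightarrow> \<bar>u i \<bullet> u j\<bar> \<le> \<mu> * (norm (u i) * norm (u j))"
    and "S \<inter> T = {}"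
  shows "\<bar>(\<Sum>i\<in>S. u i) \<bullet> (\<Sum>j\<in>T. u j)\<bar> \<le> \<mu> * ((\<Sum>i\<in>S. norm (u i)) * (\<Sum>j\<in>T. norm (u j)))"
proof -
  have "\<bar>(\<Sum>i\<in>S. u i) \<bullet> (\<Sum>j\<in>T. u j)\<bar> = \<bar>\<Sum>i\<in>S. \<Sum>j\<in>T. u i \<bullet> u j\<bar>"
    unfolding inner_sum_left by (simp only: inner_sum_right)
  also have "\<dots> \<le> (\<Sum>i\<in>S. \<Sum>j\<in>T. \<bar>u i \<bullet> u j\<bar>)"
    by (intro order_trans[OF sum_abs] sum_mono sum_abs)
  also have "\<dots> \<le> (\<Sum>i\<in>S. \<Sum>j\<in>T. \<mu> * (norm (u i) * norm (u j)))"
    using assms(2) by (intro sum_mono assms(1)) auto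
  also have "\<dots> = \<mu> * ((\<Sum>i\<in>S. norm (u i)) * (\<Sum>j\<in>T. norm (u j)))"
    unfolding sum_product by (simp only: sum_distrib_left)
  finally show ?thesis .
qed

text \<open>After expanding the square, only inner products over ordered pairs of distinct indices
  remain on the left; the bracket on the right is the sum of the products of norms over the same
  pairs. In the induction a new index \<open>k\<close> contributes its cross terms with
  \<open>S\<close>, twice.\<close>

lemma norm_sum_square_deviation:
  fixes u :: "'i \<Rightarrow> 'a::real_inner"
  assumes "\<And>i j. i \<noteq> j \<Longrightarrow> \<bar>u i \<bullet> u j\<bar> \<le> \<mu> * (norm (u i) * norm (u j))"
    and "finite S"
  shows "\<bar>(norm (\<Sum>i\<in>S. u i))\<^sup>2 - (\<Sum>i\<in>S. (norm (u i))\<^sup>2)\<bar>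
    \<le> \<mu> * ((\<Sum>i\<in>S. norm (u i))\<^sup>2 - (\<Sum>i\<in>S. (norm (u i))\<^sup>2))"
  using \<open>finite S\<close>
proof (induction S)
  case (insert k S)
  have "\<bar>(\<Sum>i\<in>{k}. u i) \<bullet> (\<Sum>j\<in>S. u j)\<bar> \<le> \<mu> * ((\<Sum>i\<in>{k}. norm (u i)) * (\<Sum>j\<in>S. norm (u j)))"
    using insert.hyps by (intro abs_inner_sum_le assms(1)) auto
  then have cross: "\<bar>u k \<bullet> (\<Sum>j\<in>S. u j)\<bar> \<le> \<mu> * (norm (u k) * (\<Sum>j\<in>S. norm (u j)))"
    by simp
  have "(norm (u k + (\<Sum>j\<in>S. u j)))\<^sup>2
      = (norm (u k))\<^sup>2 + 2 * (u k \<bullet> (\<Sum>j\<in>S. u j)) + (norm (\<Sum>j\<in>S. u j))\<^sup>2"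
    by (simp add: power2_norm_eq_inner inner_add_left inner_add_right inner_commute)
  with cross insert show ?case
    by (simp add: power2_sum algebra_simps)
qed simp

text \<open>Cauchy-Schwarz against the constant 1. An inequality for \<open>card S\<close> covers
  the case that \<open>s\<close> exceeds the number of indices, where fewer than \<open>s\<close> of
  them can be kept.\<close>

lemma sum_norm_le_sqrt:
  fixes u :: "'i \<Rightarrow> 'a::real_normed_vector"
  assumes "card S \<le> s"
  shows "(\<Sum>i\<in>S. norm (u i)) \<le> sqrt (real s) * sqrt (\<Sum>i\<in>S. (norm (u i))\<^sup>2)"
proof -
  have "(\<Sum>i\<in>S. norm (u i))\<^sup>2 \<le> (\<Sum>i\<in>S. (norm (u i))\<^sup>2) * real (card S)"
    using Cauchy_Schwarz_ineq_sum[of "\<lambda>i. norm (u i)" "\<lambda>_. 1" S] by simp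
  also have "\<dots> \<le> (\<Sum>i\<in>S. (norm (u i))\<^sup>2) * real s"
    using assms by (intro mult_left_mono) (auto intro: sum_nonneg)
  finally show ?thesis
    by (simp add: real_le_rsqrt real_sqrt_mult[symmetric] mult.commute)
qed

lemma coherent_family_bounds:
  fixes u :: "'i \<Rightarrow> 'a::real_inner"
  assumes coh: "\<And>i j. i \<noteq> j \<Longrightarrow> \<bar>u i \<bullet> u j\<bar> \<le> \<mu> * (norm (u i) * norm (u j))"
    and "0 \<le> \<mu>" and "finite I" and "S \<subseteq> I" and card: "card S \<le> s" and "1 \<le> s"
    and noise: "norm (\<Sum>i\<in>I. u i) \<le> \<tau>"
    and cone: "(\<Sum>i\<in>I - S. norm (u i)) \<le> (\<Sum>i\<in>S. norm (u i)) + 2 * sqrt (real s) * e"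
    and "0 \<le> e"
  defines "a \<equiv> sqrt (\<Sum>i\<in>S. (norm (u i))\<^sup>2)"
  shows "(1 - \<mu> * (2 * real s - 1)) * a \<le> \<tau> * sqrt (1 + (real s - 1) * \<mu>) + 2 * \<mu> * real s * e"
    and "(1 + \<mu>) * (\<Sum>i\<in>I. (norm (u i))\<^sup>2) \<le> \<tau>\<^sup>2 + 4 * real s * \<mu> * (a + e)\<^sup>2"
proof -
  define A where "A = (\<Sum>i\<in>S. norm (u i))"
  define B where "B = (\<Sum>i\<in>I - S. norm (u i))"
  let ?U = "\<Sum>i\<in>I. u i" and ?US = "\<Sum>i\<in>S. u i" and ?r = "sqrt (real s)"
  have "finite S"
    using \<open>S \<subseteq> I\<close> \<open>finite I\<close> by (rule finite_subset)
  have a0: "0 \<le> a" and a2: "a\<^sup>2 = (\<Sum>i\<in>S. (norm (u i))\<^sup>2)"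
    by (simp_all add: a_def sum_nonneg)
  have A0: "0 \<le> A" and B0: "0 \<le> B"
    by (simp_all add: A_def B_def sum_nonneg)
  have "0 \<le> \<tau>"
    using noise norm_ge_zero order_trans by blast
  have Aa: "A \<le> ?r * a"
    unfolding A_def a_def using card by (rule sum_norm_le_sqrt)
  have BA: "B \<le> A + 2 * ?r * e"
    using cone by (simp add: A_def B_def)
  have A2: "A\<^sup>2 \<le> real s * a\<^sup>2"
    using power_mono[OF Aa A0, of 2] by (simp add: power_mult_distrib)
  have dev: "\<bar>(norm ?US)\<^sup>2 - a\<^sup>2\<bar> \<le> \<mu> * (A\<^sup>2 - a\<^sup>2)"
    using norm_sum_square_deviation[of u, OF coh \<open>finite S\<close>] by (simp add: a2 A_def)
  \<comment> \<open>Together with \<open>dev\<close> this is a restricted isometry estimate on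
    \<open>S\<close> with constant \<open>(s - 1) * \<mu>\<close>.\<close>
  have dev': "\<mu> * (A\<^sup>2 - a\<^sup>2) \<le> \<mu> * (real s - 1) * a\<^sup>2"
    using mult_left_mono[OF A2 \<open>0 \<le> \<mu>\<close>] by (simp add: algebra_simps)
  have upper: "norm ?US \<le> sqrt (1 + (real s - 1) * \<mu>) * a"
  proof (rule power2_le_imp_le)
    have "0 \<le> 1 + (real s - 1) * \<mu>"
      using \<open>1 \<le> s\<close> \<open>0 \<le> \<mu>\<close> by simp
    moreover have "(norm ?US)\<^sup>2 \<le> (1 + (real s - 1) * \<mu>) * a\<^sup>2"
      using dev dev' by (simp add: algebra_simps)
    ultimately show "(norm ?US)\<^sup>2 \<le> (sqrt (1 + (real s - 1) * \<mu>) * a)\<^sup>2"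
      by (simp add: power_mult_distrib)
  qed (use a0 \<open>1 \<le> s\<close> \<open>0 \<le> \<mu>\<close> in simp)
  have "?US \<bullet> ?U = (norm ?US)\<^sup>2 + ?US \<bullet> (\<Sum>i\<in>I - S. u i)"
    using sum.subset_diff[OF \<open>S \<subseteq> I\<close> \<open>finite I\<close>, of u]
    by (simp add: inner_add_right power2_norm_eq_inner)
  moreover have "\<bar>?US \<bullet> (\<Sum>i\<in>I - S. u i)\<bar> \<le> \<mu> * (A * B)"
    unfolding A_def B_def by (intro abs_inner_sum_le coh) auto
  moreover have "?US \<bullet> ?U \<le> (sqrt (1 + (real s - 1) * \<mu>) * a) * \<tau>"
    using norm_cauchy_schwarz[of ?US ?U] mult_mono[OF upper noise] a0 \<open>1 \<le> s\<close> \<open>0 \<le> \<mu>\<close>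
    by simp
  moreover have "A * B \<le> real s * a\<^sup>2 + 2 * real s * e * a"
  proof -
    have "A * B \<le> (?r * a) * (?r * a + 2 * ?r * e)"
      using Aa BA A0 B0 a0 by (intro mult_mono) auto
    also have "\<dots> = ?r\<^sup>2 * a\<^sup>2 + 2 * ?r\<^sup>2 * e * a"
      by (simp add: power2_eq_square algebra_simps del: real_sqrt_mult_self)
    finally show ?thesis by simp
  qed
  then have "\<mu> * (A * B) \<le> \<mu> * (real s * a\<^sup>2 + 2 * real s * e * a)"
    using \<open>0 \<le> \<mu>\<close> by (rule mult_left_mono)
  \<comment> \<open>The isometry estimate costs \<open>(s - 1) * \<mu>\<close> and the cross term
    with \<open>I - S\<close> costs \<open>s * \<mu>\<close>, which add up to
    \<open>\<mu> * (2 * s - 1)\<close>. The common factor \<open>a\<close> is cancelled below; for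
    \<open>a = 0\<close> the claim is the nonnegativity of its right side.\<close>
  ultimately have "a * ((1 - \<mu> * (2 * real s - 1)) * a)
      \<le> a * (\<tau> * sqrt (1 + (real s - 1) * \<mu>) + 2 * \<mu> * real s * e)"
    using dev dev' by (simp add: algebra_simps power2_eq_square)
  moreover have "0 \<le> \<tau> * sqrt (1 + (real s - 1) * \<mu>) + 2 * \<mu> * real s * e"
    using \<open>0 \<le> \<tau>\<close> \<open>1 \<le> s\<close> \<open>0 \<le> \<mu>\<close> \<open>0 \<le> e\<close> by simp
  ultimately show "(1 - \<mu> * (2 * real s - 1)) * a
      \<le> \<tau> * sqrt (1 + (real s - 1) * \<mu>) + 2 * \<mu> * real s * e"
    using a0 by (cases "a = 0") auto
  have total: "(\<Sum>i\<in>I. norm (u i)) = A + B"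
    using sum.subset_diff[OF \<open>S \<subseteq> I\<close> \<open>finite I\<close>, of "\<lambda>i. norm (u i)"]
    by (simp add: A_def B_def)
  have "A + B \<le> 2 * ?r * (a + e)"
    using Aa BA by (simp add: algebra_simps)
  then have "(A + B)\<^sup>2 \<le> (2 * ?r * (a + e))\<^sup>2"
    using A0 B0 by (intro power_mono) auto
  then have "(A + B)\<^sup>2 \<le> 4 * real s * (a + e)\<^sup>2"
    by (simp add: power_mult_distrib)
  then have "\<mu> * (A + B)\<^sup>2 \<le> \<mu> * (4 * real s * (a + e)\<^sup>2)"
    using \<open>0 \<le> \<mu>\<close> by (rule mult_left_mono)
  \<comment> \<open>The diagonal subtracted inside the bracket moves to the other side and produces
    the factor \<open>1 + \<mu>\<close>.\<close>
  moreover have "\<bar>(norm ?U)\<^sup>2 - (\<Sum>i\<in>I. (norm (u i))\<^sup>2)\<bar>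
      \<le> \<mu> * ((A + B)\<^sup>2 - (\<Sum>i\<in>I. (norm (u i))\<^sup>2))"
    using norm_sum_square_deviation[of u, OF coh \<open>finite I\<close>] by (simp add: total)
  moreover have "(norm ?U)\<^sup>2 \<le> \<tau>\<^sup>2"
    using noise by (intro power_mono) auto
  ultimately show "(1 + \<mu>) * (\<Sum>i\<in>I. (norm (u i))\<^sup>2) \<le> \<tau>\<^sup>2 + 4 * real s * \<mu> * (a + e)\<^sup>2"
    by (simp add: algebra_simps abs_le_iff)
qed

section \<open>Real inequalities behind the two error constants\<close>

lemma noise_constant_bound:
  fixes s \<mu> :: real
  assumes "1 \<le> s" "0 \<le> \<mu>" "\<mu> < 1 / (2 * s - 1)"
  shows "(1 - \<mu> * (2 * s - 1))\<^sup>2 + 4 * s * \<mu> * (1 + (s - 1) * \<mu>)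
    \<le> (3 - 1 / (2 * s - 1)) * (1 + \<mu>)"
proof -
  \<comment> \<open>In terms of \<open>m\<close> the left side is
    \<open>1 + 2 * \<mu> + (2 * m^2 - 1) * \<mu>^2\<close>. The difference of the two sides vanishes
    at \<open>\<mu> = 1 / m\<close>, which gives the factorization below.\<close>
  define m where "m = 2 * s - 1"
  have s: "s = (m + 1) / 2" and m: "1 \<le> m"
    using assms by (simp_all add: m_def)
  have "1 \<le> 2 * m\<^sup>2"
    using one_le_power[OF m, of 2] by linarith
  moreover have "\<mu> \<le> 1 / m"
    using assms by (simp add: m_def)
  ultimately have "0 \<le> (1 / m - \<mu>) * ((2 * m\<^sup>2 - 1) * \<mu> + (2 * m - 1))"
    using assms m by (intro mult_nonneg_nonneg add_nonneg_nonneg) auto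
  also have "\<dots> = (3 - 1 / m) * (1 + \<mu>) - ((1 - \<mu> * m)\<^sup>2 + 4 * s * \<mu> * (1 + (s - 1) * \<mu>))"
    using m unfolding s by (simp add: field_simps power2_eq_square)
  finally show ?thesis
    by (simp add: m_def)
qed

lemma error_bound_from_quadratic:
  fixes s \<mu> \<tau> e a X :: real
  assumes s: "1 \<le> s" and \<mu>: "0 \<le> \<mu>" "\<mu> < 1 / (2 * s - 1)"
    and "0 \<le> \<tau>" "0 \<le> e" "0 \<le> a"
    and a: "(1 - \<mu> * (2 * s - 1)) * a \<le> \<tau> * sqrt (1 + (s - 1) * \<mu>) + 2 * \<mu> * s * e"
    and X: "(1 + \<mu>) * X\<^sup>2 \<le> \<tau>\<^sup>2 + 4 * s * \<mu> * (a + e)\<^sup>2"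
  shows "X \<le> sqrt (3 - 1 / (2 * s - 1)) / (1 - \<mu> * (2 * s - 1)) * \<tau>
    + 2 * sqrt (\<mu> * s * (1 + \<mu>)) / (1 - \<mu> * (2 * s - 1)) * e"
proof -
  define D where "D = 1 - \<mu> * (2 * s - 1)"
  define g where "g = sqrt (1 + (s - 1) * \<mu>)"
  define k where "k = 2 * sqrt (s * \<mu>)"
  define q where "q = sqrt (1 + \<mu>)"
  have D: "0 < D"
    using \<mu> s by (simp add: D_def field_simps)
  have g: "0 \<le> g" "g\<^sup>2 = 1 + (s - 1) * \<mu>" and k: "0 \<le> k" "k\<^sup>2 = 4 * s * \<mu>"
    and q: "0 < q" "q\<^sup>2 = 1 + \<mu>"
    using s \<mu> by (simp_all add: g_def k_def q_def power_mult_distrib)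
  \<comment> \<open>\<open>D * e\<close> is added to both sides of the bound on \<open>a\<close>:
    since \<open>D + 2 * \<mu> * s = 1 + \<mu>\<close>, the coefficient of \<open>e\<close> becomes
    \<open>q^2\<close>.\<close>
  have "D * (a + e) \<le> \<tau> * g + q\<^sup>2 * e"
    using a by (simp add: D_def g_def q algebra_simps)
  then have "k * (D * (a + e)) \<le> k * (\<tau> * g + q\<^sup>2 * e)"
    using k(1) by (rule mult_left_mono)
  moreover have "0 \<le> k * (D * (a + e))"
    using k D \<open>0 \<le> a\<close> \<open>0 \<le> e\<close> by simp
  ultimately have "(k * (D * (a + e)))\<^sup>2 \<le> (k * (\<tau> * g + q\<^sup>2 * e))\<^sup>2"
    by (rule power_mono)
  moreover have "D\<^sup>2 * (q\<^sup>2 * X\<^sup>2) \<le> D\<^sup>2 * (\<tau>\<^sup>2 + k\<^sup>2 * (a + e)\<^sup>2)"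
    using X by (intro mult_left_mono) (auto simp: q k)
  moreover have "D\<^sup>2 * (\<tau>\<^sup>2 + k\<^sup>2 * (a + e)\<^sup>2) = (D * \<tau>)\<^sup>2 + (k * (D * (a + e)))\<^sup>2"
    by (simp add: power2_eq_square algebra_simps)
  moreover have "k * (\<tau> * g + q\<^sup>2 * e) = k * g * \<tau> + k * q\<^sup>2 * e"
    by (simp add: algebra_simps)
  \<comment> \<open>The added 0 prepares Minkowski's inequality for the plane vectors
    \<open>(D * \<tau>, k * g * \<tau>)\<close> and \<open>(0, k * q^2 * e)\<close>, which separates
    noise from truncation error.\<close>
  ultimately have "(D * q * X)\<^sup>2 \<le> (D * \<tau> + 0)\<^sup>2 + (k * g * \<tau> + k * q\<^sup>2 * e)\<^sup>2"
    by (simp add: power_mult_distrib mult.assoc)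
  then have "D * q * X \<le> sqrt ((D * \<tau> + 0)\<^sup>2 + (k * g * \<tau> + k * q\<^sup>2 * e)\<^sup>2)"
    by (rule real_le_rsqrt)
  also have "\<dots> \<le> sqrt ((D * \<tau>)\<^sup>2 + (k * g * \<tau>)\<^sup>2) + sqrt (0\<^sup>2 + (k * q\<^sup>2 * e)\<^sup>2)"
    by (rule real_sqrt_sum_squares_triangle_ineq)
  also have "sqrt (0\<^sup>2 + (k * q\<^sup>2 * e)\<^sup>2) = k * q\<^sup>2 * e"
    using k \<open>0 \<le> e\<close> by simp
  also have "(D * \<tau>)\<^sup>2 + (k * g * \<tau>)\<^sup>2 = (D\<^sup>2 + k\<^sup>2 * g\<^sup>2) * \<tau>\<^sup>2"
    by (simp add: power_mult_distrib algebra_simps)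
  \<comment> \<open>\<open>D^2 + k^2 * g^2\<close> is the left side of
    \<open>noise_constant_bound\<close>.\<close>
  also have "sqrt \<dots> \<le> sqrt ((3 - 1 / (2 * s - 1)) * q\<^sup>2 * \<tau>\<^sup>2)"
    using noise_constant_bound[OF s \<mu>]
    by (intro real_sqrt_le_mono mult_right_mono) (simp_all add: D_def g k q)
  also have "\<dots> = sqrt (3 - 1 / (2 * s - 1)) * q * \<tau>"
    using q(1) \<open>0 \<le> \<tau>\<close> by (simp add: real_sqrt_mult)
  finally have "q * (D * X) \<le> q * (sqrt (3 - 1 / (2 * s - 1)) * \<tau> + k * q * e)"
    by (simp add: algebra_simps power2_eq_square)
  then have "D * X \<le> sqrt (3 - 1 / (2 * s - 1)) * \<tau> + k * q * e"
    using q(1) by (rule mult_left_le_imp_le)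
  then have "X \<le> (sqrt (3 - 1 / (2 * s - 1)) * \<tau> + k * q * e) / D"
    using D by (simp add: pos_le_divide_eq mult.commute)
  also have "k * q = 2 * sqrt (\<mu> * s * (1 + \<mu>))"
    by (simp add: k_def q_def real_sqrt_mult mult.commute)
  finally show ?thesis
    by (simp add: D_def add_divide_distrib)
qed

section \<open>Reduction of the recovery estimate to the family \<open>u\<close>\<close>

theorem theorem8:
  fixes f :: "'N::finite \<Rightarrow> 'a::euclidean_space"
    and c cs cstar :: "real ^ 'N"
    and y z :: 'a
    and \<mu> \<epsilon> \<eta> e0 :: real
    and w :: "'N \<Rightarrow> real"
    and s :: nat
  assumes f_nonzero: "\<And>i. f i \<noteq> 0"
    and w_def: "w = (\<lambda>i. norm (f i))"
    and mu_def: "\<mu> = coherence f"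
    and eps_nonneg: "0 \<le> \<epsilon>" and eta_nonneg: "0 \<le> \<eta>"
    and s_pos: "1 \<le> s"
    and mu_bound: "\<mu> < 1 / (2 * real s - 1)"
    and y_eq: "y = synthesis f c + z"
    and noise: "norm z \<le> \<epsilon>"
    and feasible: "norm z \<le> \<eta>"
    and solution: "P1w_solution f y \<eta> cstar"
    and truncation: "largest_entries s c cs"
    and e0_def: "e0 = wnorm 1 w (c - cs) / sqrt (real s)"
  shows "wnorm 2 w (cstar - c)
    \<le> sqrt (3 - 1 / (2 * real s - 1)) / (1 - \<mu> * (2 * real s - 1)) * (\<eta> + \<epsilon>)
      + 2 * sqrt (\<mu> * real s * (1 + \<mu>)) / (1 - \<mu> * (2 * real s - 1)) * e0"
proof -
  obtain S where S: "card S = min s CARD('N)" and cs: "cs = (\<chi> i. if i \<in> S then c $ i else 0)"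
    using truncation unfolding largest_entries_def by blast
  define h where "h = cstar - c"
  define u where "u i = (h $ i) *\<^sub>R f i" for i
  have w: "0 \<le> w i" for i
    by (simp add: w_def)
  have norm_u: "norm (u i) = \<bar>h $ i\<bar> * w i" for i
    by (simp add: u_def w_def)
  have \<mu>0: "0 \<le> \<mu>"
    by (simp add: mu_def coherence_nonneg)
  \<comment> \<open>The coherence bound is homogeneous in each vector, so rescaling
    \<open>f i\<close> to \<open>u i\<close> keeps the same \<mu>.\<close>
  have coh: "\<bar>u i \<bullet> u j\<bar> \<le> \<mu> * (norm (u i) * norm (u j))" if "i \<noteq> j" for i j
  proof -
    have "\<bar>h $ i * h $ j\<bar> * \<bar>f i \<bullet> f j\<bar> \<le> \<bar>h $ i * h $ j\<bar> * (\<mu> * (norm (f i) * norm (f j)))"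
      unfolding mu_def by (intro mult_left_mono abs_inner_le_coherence that) simp
    then show ?thesis
      by (simp add: u_def abs_mult mult_ac)
  qed
  have sum_u: "(\<Sum>i\<in>UNIV. u i) = synthesis f cstar - synthesis f c"
    by (simp add: synthesis_def u_def h_def scaleR_diff_left sum_subtractf)
  have arg_min: "is_arg_min (wnorm 1 w) (\<lambda>c'. norm (y - synthesis f c') \<le> \<eta>) cstar"
    using solution by (simp add: P1w_solution_def w_def)
  have "norm (y - synthesis f cstar) \<le> \<eta>"
    using arg_min by (simp add: is_arg_min_def)
  moreover have "(\<Sum>i\<in>UNIV. u i) = z - (y - synthesis f cstar)"
    by (simp add: sum_u y_eq)
  ultimately have noise_u: "norm (\<Sum>i\<in>UNIV. u i) \<le> \<eta> + \<epsilon>"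
    using noise norm_triangle_ineq4[of z "y - synthesis f cstar"] by simp
  \<comment> \<open>Since \<open>y - synthesis f c = z\<close>, the assumption
    \<open>feasible\<close> makes \<open>c\<close> itself a competitor in the minimization.\<close>
  have "wnorm 1 w cstar \<le> wnorm 1 w c"
    using arg_min feasible by (auto simp: is_arg_min_def y_eq not_less)
  then have min: "(\<Sum>i\<in>UNIV. \<bar>cstar $ i\<bar> * w i) \<le> (\<Sum>i\<in>UNIV. \<bar>c $ i\<bar> * w i)"
    by (simp add: wnorm_1_eq w)
  have split: "sum g UNIV = sum g S + sum g (- S)" for g :: "'N \<Rightarrow> real"
    using sum.subset_diff[of S UNIV g] by (simp add: Compl_eq_Diff_UNIV add.commute)
  \<comment> \<open>The triangle inequality for \<open>cstar = c + h\<close> is used in two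
    directions: \<open>c\<close> is the leading term on \<open>S\<close>, and \<open>h\<close> is
    the leading term off \<open>S\<close>. Summed and compared with \<open>min\<close>, these give
    the cone condition.\<close>
  have on: "\<bar>c $ i\<bar> * w i - norm (u i) \<le> \<bar>cstar $ i\<bar> * w i" for i
  proof -
    have "(\<bar>c $ i\<bar> - \<bar>h $ i\<bar>) * w i \<le> \<bar>cstar $ i\<bar> * w i"
      by (intro mult_right_mono w) (simp add: h_def)
    then show ?thesis
      by (simp add: norm_u algebra_simps)
  qed
  have off: "norm (u i) - \<bar>c $ i\<bar> * w i \<le> \<bar>cstar $ i\<bar> * w i" for i
  proof -
    have "(\<bar>h $ i\<bar> - \<bar>c $ i\<bar>) * w i \<le> \<bar>cstar $ i\<bar> * w i"
      by (intro mult_right_mono w) (simp add: h_def)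
    then show ?thesis
      by (simp add: norm_u algebra_simps)
  qed
  have "(\<Sum>i\<in>S. \<bar>c $ i\<bar> * w i) - (\<Sum>i\<in>S. norm (u i)) \<le> (\<Sum>i\<in>S. \<bar>cstar $ i\<bar> * w i)"
    unfolding sum_subtractf[symmetric] by (intro sum_mono on)
  moreover have "(\<Sum>i\<in>- S. norm (u i)) - (\<Sum>i\<in>- S. \<bar>c $ i\<bar> * w i) \<le> (\<Sum>i\<in>- S. \<bar>cstar $ i\<bar> * w i)"
    unfolding sum_subtractf[symmetric] by (intro sum_mono off)
  ultimately have "(\<Sum>i\<in>- S. norm (u i)) \<le> (\<Sum>i\<in>S. norm (u i)) + 2 * (\<Sum>i\<in>- S. \<bar>c $ i\<bar> * w i)"
    using min split[of "\<lambda>i. \<bar>cstar $ i\<bar> * w i"] split[of "\<lambda>i. \<bar>c $ i\<bar> * w i"] by linarith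
  moreover have "wnorm 1 w (c - cs) = (\<Sum>i\<in>- S. \<bar>c $ i\<bar> * w i)"
    by (simp add: wnorm_1_eq w split cs)
  moreover have "sqrt (real s) * e0 = wnorm 1 w (c - cs)"
    using s_pos by (simp add: e0_def)
  ultimately have cone: "(\<Sum>i\<in>UNIV - S. norm (u i))
      \<le> (\<Sum>i\<in>S. norm (u i)) + 2 * sqrt (real s) * e0"
    by (simp add: Compl_eq_Diff_UNIV)
  have e0: "0 \<le> e0"
    by (simp add: e0_def wnorm_def)
  have card: "card S \<le> s"
    by (simp add: S)
  have X: "(wnorm 2 w (cstar - c))\<^sup>2 = (\<Sum>i\<in>UNIV. (norm (u i))\<^sup>2)"
    unfolding wnorm_2_eq[OF w] by (simp add: norm_u h_def sum_nonneg)
  note bounds = coherent_family_bounds[OF coh \<mu>0 finite subset_UNIV card s_pos noise_u cone e0]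
  show ?thesis
    using s_pos \<mu>0 mu_bound eta_nonneg eps_nonneg e0 bounds
    by (intro error_bound_from_quadratic[where a = "sqrt (\<Sum>i\<in>S. (norm (u i))\<^sup>2)"])
      (simp_all add: X sum_nonneg)
qed

end
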